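(* Let $G$ be a group with center $Z_G$. The coarse space $\stackrel{\leftrightarrow}{G}$ is cellular if and only if the quotient group $G/Z_G$ is locally finite.
   Context: A coarse structure on a set $X$ is a family $\mathcal{E}$ of subsets of $X\times X$ such that: each $E\in\mathcal{E}$ contains the diagonal $\Delta_X=\{(x,x):x\in X\}$; if $E,E'\in\mathcal{E}$ then $E\circ E'=\{(x,y):\exists z\,((x,z)\in E,\ (z,y)\in E')\}\in\mathcal{E}$ and $E^{-1}=\{(y,x):(x,y)\in E\}\in\mathcal{E}$; if $E\in\mathcal{E}$ and $\Delta_X\subseteq E'\subseteq E$ then $E'\in\mathcal{E}$. The pair $(X,\mathcal{E})$ is a coarse space. A subfamily $\mathcal{E}'\subseteq\mathcal{E}$ is a base for $\mathcal{E}$ if every $E\in\mathcal{E}$ is contained in some $E'\in\mathcal{E}'$. A coarse space $(X,\mathcal{E})$ is cellular if $\mathcal{E}$ has a base consisting of equivalence relations on $X$. For a group $G$ with identity $e$, $x,g\in G$ and $F\subseteq G$, write $x^g=g^{-1}xg$ and $x^F=\{x^y:y\in F\}$. $\stackrel{\leftrightarrow}{G}$ denotes the set $G$ endowed with the coarse structure having base $\{\{(x,y)\in G\times G: y\in x^F\}: F\subseteq G \text{ finite},\ e\in F\}$. A group is locally finite if each of its finite subsets generates a finite subgroup. *)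

theory Defs
  imports "HOL-Algebra.Generated_Groups"
begin

definition coarse_structure :: "'a set \<Rightarrow> 'a rel set \<Rightarrow> bool" where
  "coarse_structure X \<E> \<longleftrightarrow>
     (\<forall>E\<in>\<E>. E \<subseteq> X \<times> X \<and> Id_on X \<subseteq> E) \<and>
     (\<forall>E\<in>\<E>. \<forall>E'\<in>\<E>. E O E' \<in> \<E>) \<and>
     (\<forall>E\<in>\<E>. E\<inverse> \<in> \<E>) \<and>
     (\<forall>E\<in>\<E>. \<forall>E'. Id_on X \<subseteq> E' \<and> E' \<subseteq> E \<longrightarrow> E' \<in> \<E>)"

definition coarse_base :: "'a rel set \<Rightarrow> 'a rel set \<Rightarrow> bool" where
  "coarse_base \<B> \<E> \<longleftrightarrow> \<B> \<subseteq> \<E> \<and> (\<forall>E\<in>\<E>. \<exists>E'\<in>\<B>. E \<subseteq> E')"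

definition cellular :: "'a set \<Rightarrow> 'a rel set \<Rightarrow> bool" where
  "cellular X \<E> \<longleftrightarrow> coarse_structure X \<E> \<and> (\<exists>\<B>. coarse_base \<B> \<E> \<and> (\<forall>R\<in>\<B>. equiv X R))"

text \<open>A coarse structure is determined by any of its bases, as the family below
  (see \<open>coarse_structure_with_base_unique\<close>).\<close>

definition coarse_structure_with_base :: "'a set \<Rightarrow> 'a rel set \<Rightarrow> 'a rel set" where
  "coarse_structure_with_base X \<B> = {E. Id_on X \<subseteq> E \<and> (\<exists>R\<in>\<B>. E \<subseteq> R)}"

lemma coarse_structure_with_base_unique:
  assumes "coarse_structure X \<E>" "coarse_base \<B> \<E>"
  shows "\<E> = coarse_structure_with_base X \<B>"
proof
  show "\<E> \<subseteq> coarse_structure_with_base X \<B>"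
    using assms by (auto simp: coarse_structure_def coarse_base_def coarse_structure_with_base_def)
  show "coarse_structure_with_base X \<B> \<subseteq> \<E>"
  proof
    fix E assume "E \<in> coarse_structure_with_base X \<B>"
    then obtain R where "Id_on X \<subseteq> E" "R \<in> \<E>" "E \<subseteq> R"
      using assms(2) unfolding coarse_base_def coarse_structure_with_base_def by blast
    moreover have "\<forall>E\<in>\<E>. \<forall>E'. Id_on X \<subseteq> E' \<and> E' \<subseteq> E \<longrightarrow> E' \<in> \<E>"
      using assms(1) unfolding coarse_structure_def by (elim conjE)
    ultimately show "E \<in> \<E>" by blast
  qed
qed

definition conjugate :: "('a, 'b) monoid_scheme \<Rightarrow> 'a \<Rightarrow> 'a \<Rightarrow> 'a" where
  "conjugate G x g = inv\<^bsub>G\<^esub> g \<otimes>\<^bsub>G\<^esub> x \<otimes>\<^bsub>G\<^esub> g"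

definition conj_entourage :: "('a, 'b) monoid_scheme \<Rightarrow> 'a set \<Rightarrow> 'a rel" where
  "conj_entourage G F = {(x, y) \<in> carrier G \<times> carrier G. y \<in> conjugate G x ` F}"

definition conj_entourages :: "('a, 'b) monoid_scheme \<Rightarrow> 'a rel set" where
  "conj_entourages G = {conj_entourage G F | F. F \<subseteq> carrier G \<and> finite F \<and> \<one>\<^bsub>G\<^esub> \<in> F}"

definition conj_coarse :: "('a, 'b) monoid_scheme \<Rightarrow> 'a rel set" where
  "conj_coarse G = coarse_structure_with_base (carrier G) (conj_entourages G)"

definition center :: "('a, 'b) monoid_scheme \<Rightarrow> 'a set" where
  "center G = {z \<in> carrier G. \<forall>g\<in>carrier G. z \<otimes>\<^bsub>G\<^esub> g = g \<otimes>\<^bsub>G\<^esub> z}"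

definition locally_finite :: "('a, 'b) monoid_scheme \<Rightarrow> bool" where
  "locally_finite G \<longleftrightarrow> group G \<and> (\<forall>S. S \<subseteq> carrier G \<and> finite S \<longrightarrow> finite (generate G S))"

context group
begin

lemma center_normal: "center G \<lhd> G"
proof -
  have sub: "center G \<subseteq> carrier G" by (auto simp: center_def)
  have comm: "z \<otimes> g = g \<otimes> z" if "z \<in> center G" "g \<in> carrier G" for z g
    using that by (simp add: center_def)
  have "subgroup (center G) G"
  proof (rule subgroupI)
    show "center G \<subseteq> carrier G" by (rule sub)
    have "\<one> \<in> center G" by (simp add: center_def)
    then show "center G \<noteq> {}" by blast
  next
    fix a assume a: "a \<in> center G"
    then have ac: "a \<in> carrier G" using sub by blast
    have "inv a \<otimes> g = g \<otimes> inv a" if g: "g \<in> carrier G" for g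
    proof -
      have "inv a \<otimes> g = inv (inv g \<otimes> a)" using ac g by (simp add: inv_mult_group)
      also have "inv g \<otimes> a = a \<otimes> inv g" using comm[OF a, of "inv g"] g by simp
      also have "inv (a \<otimes> inv g) = g \<otimes> inv a" using ac g by (simp add: inv_mult_group)
      finally show ?thesis .
    qed
    then show "inv a \<in> center G" using ac by (simp add: center_def)
  next
    fix a b assume a: "a \<in> center G" and b: "b \<in> center G"
    then have ab: "a \<in> carrier G" "b \<in> carrier G" using sub by blast+
    have "a \<otimes> b \<otimes> g = g \<otimes> (a \<otimes> b)" if g: "g \<in> carrier G" for g
    proof -
      have "a \<otimes> b \<otimes> g = a \<otimes> (b \<otimes> g)" using ab g by (simp add: m_assoc)
      also have "b \<otimes> g = g \<otimes> b" by (rule comm[OF b g])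
      also have "a \<otimes> (g \<otimes> b) = a \<otimes> g \<otimes> b" using ab g by (simp add: m_assoc)
      also have "a \<otimes> g = g \<otimes> a" by (rule comm[OF a g])
      also have "g \<otimes> a \<otimes> b = g \<otimes> (a \<otimes> b)" using ab g by (simp add: m_assoc)
      finally show ?thesis .
    qed
    then show "a \<otimes> b \<in> center G" using ab by (simp add: center_def)
  qed
  moreover have "x \<otimes> h \<otimes> inv x \<in> center G" if x: "x \<in> carrier G" and h: "h \<in> center G" for x h
  proof -
    have hc: "h \<in> carrier G" using h sub by blast
    have "x \<otimes> h \<otimes> inv x = h \<otimes> x \<otimes> inv x" using comm[OF h x] by simp
    also have "\<dots> = h" using hc x by (simp add: m_assoc)
    finally show ?thesis using h by simp
  qed
  ultimately show ?thesis by (simp add: normal_inv_iff)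
qed

lemma conjugate_closed: "x \<in> carrier G \<Longrightarrow> g \<in> carrier G \<Longrightarrow> conjugate G x g \<in> carrier G"
  by (simp add: conjugate_def)

lemma conjugate_one: "x \<in> carrier G \<Longrightarrow> conjugate G x \<one> = x"
  by (simp add: conjugate_def)

lemma conjugate_mult:
  "x \<in> carrier G \<Longrightarrow> g \<in> carrier G \<Longrightarrow> h \<in> carrier G \<Longrightarrow>
    conjugate G (conjugate G x g) h = conjugate G x (g \<otimes> h)"
  by (simp add: conjugate_def inv_mult_group m_assoc)

lemma conj_coarse_structure: "coarse_structure (carrier G) (conj_coarse G)"
proof -
  have mem: "E \<in> conj_coarse G \<longleftrightarrow> Id_on (carrier G) \<subseteq> E \<and>
      (\<exists>F. F \<subseteq> carrier G \<and> finite F \<and> \<one> \<in> F \<and> E \<subseteq> conj_entourage G F)" for E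
    unfolding conj_coarse_def coarse_structure_with_base_def conj_entourages_def by blast
  have 1: "E \<subseteq> carrier G \<times> carrier G \<and> Id_on (carrier G) \<subseteq> E" if "E \<in> conj_coarse G" for E
    using that unfolding mem conj_entourage_def by blast
  have 2: "E O E' \<in> conj_coarse G" if E: "E \<in> conj_coarse G" and E': "E' \<in> conj_coarse G" for E E'
  proof -
    obtain F F' where F: "F \<subseteq> carrier G" "finite F" "\<one> \<in> F" "E \<subseteq> conj_entourage G F"
      and F': "F' \<subseteq> carrier G" "finite F'" "\<one> \<in> F'" "E' \<subseteq> conj_entourage G F'"
      using E E' unfolding mem by blast
    define K where "K = (\<lambda>(g, h). g \<otimes> h) ` (F \<times> F')"
    have "E O E' \<subseteq> conj_entourage G K"
    proof
      fix p assume "p \<in> E O E'"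
      then obtain x z y where p: "p = (x, y)" "(x, z) \<in> E" "(z, y) \<in> E'" by blast
      obtain g where g: "x \<in> carrier G" "g \<in> F" "z = conjugate G x g"
        using F(4) p(2) unfolding conj_entourage_def by blast
      obtain h where h: "y \<in> carrier G" "h \<in> F'" "y = conjugate G z h"
        using F'(4) p(3) unfolding conj_entourage_def by blast
      have "y = conjugate G x (g \<otimes> h)"
        using g h F(1) F'(1) conjugate_mult by blast
      moreover have "g \<otimes> h \<in> K" using g h unfolding K_def by blast
      ultimately show "p \<in> conj_entourage G K"
        using p g h unfolding conj_entourage_def by blast
    qed
    moreover have "K \<subseteq> carrier G" using F F' unfolding K_def by auto
    moreover have "finite K" using F F' unfolding K_def by simp
    moreover have "\<one> \<in> K" using F F' unfolding K_def by (intro image_eqI[of _ _ "(\<one>, \<one>)"]) simp_all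
    moreover have "Id_on (carrier G) \<subseteq> E O E'" using 1[OF E] 1[OF E'] by blast
    ultimately show ?thesis unfolding mem by blast
  qed
  have 3: "E\<inverse> \<in> conj_coarse G" if E: "E \<in> conj_coarse G" for E
  proof -
    obtain F where F: "F \<subseteq> carrier G" "finite F" "\<one> \<in> F" "E \<subseteq> conj_entourage G F"
      using E unfolding mem by blast
    have "E\<inverse> \<subseteq> conj_entourage G (m_inv G ` F)"
    proof
      fix p assume "p \<in> E\<inverse>"
      then obtain x y where p: "p = (y, x)" "(x, y) \<in> E" by blast
      obtain g where g: "x \<in> carrier G" "y \<in> carrier G" "g \<in> F" "y = conjugate G x g"
        using F(4) p(2) unfolding conj_entourage_def by blast
      have gc: "g \<in> carrier G" using g F(1) by blast
      have "x = conjugate G y (inv g)"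
        using g gc by (simp add: conjugate_mult conjugate_one)
      then show "p \<in> conj_entourage G (m_inv G ` F)"
        using p g unfolding conj_entourage_def by blast
    qed
    moreover have "m_inv G ` F \<subseteq> carrier G" using F by auto
    moreover have "finite (m_inv G ` F)" using F by simp
    moreover have "\<one> \<in> m_inv G ` F" using F(3) by (metis image_eqI inv_one)
    moreover have "Id_on (carrier G) \<subseteq> E\<inverse>" using 1[OF E] by blast
    ultimately show ?thesis unfolding mem by blast
  qed
  have 4: "E' \<in> conj_coarse G" if "E \<in> conj_coarse G" "Id_on (carrier G) \<subseteq> E'" "E' \<subseteq> E" for E E'
    using that unfolding mem by blast
  show ?thesis
    unfolding coarse_structure_def
  proof (intro conjI ballI allI impI)
    fix E E' assume "E \<in> conj_coarse G" "Id_on (carrier G) \<subseteq> E' \<and> E' \<subseteq> E"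
    then show "E' \<in> conj_coarse G" using 4 by (elim conjE)
  qed (simp_all add: 1 2 3)
qed

lemma conj_entourages_base: "coarse_base (conj_entourages G) (conj_coarse G)"
proof -
  have "Id_on (carrier G) \<subseteq> conj_entourage G F" if "\<one> \<in> F" for F
  proof
    fix p assume "p \<in> Id_on (carrier G)"
    then obtain x where x: "x \<in> carrier G" "p = (x, x)" by blast
    have "x \<in> conjugate G x ` F" using that conjugate_one[OF x(1)] by (metis image_eqI)
    then show "p \<in> conj_entourage G F" using x by (simp add: conj_entourage_def)
  qed
  then have "Id_on (carrier G) \<subseteq> R" if "R \<in> conj_entourages G" for R
    using that unfolding conj_entourages_def by blast
  then show ?thesis
    unfolding coarse_base_def conj_coarse_def coarse_structure_with_base_def by blast
qed

end

end

theory Submission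
  imports Defs
begin

text \<open>
  Cellularity says that for every finitely generated subgroup \<open>H\<close> there is one finite set \<open>K\<close> with
  \<open>x\<^sup>H \<subseteq> x\<^sup>K\<close> for all \<open>x\<close>. If \<open>H\<close> is finite modulo the center, representatives of \<open>H\<close> serve as
  \<open>K\<close>. Conversely, given \<open>K\<close>, for each \<open>h \<in> H\<close> the group is the union of the centralizers of
  \<open>h k\<^sup>-\<^sup>1\<close> with \<open>k \<in> K\<close>, so by B. H. Neumann's covering lemma some \<open>h k\<^sup>-\<^sup>1\<close> has a finite conjugacy
  class. By Schreier's argument \<open>H = A R\<close> with \<open>R\<close> finite and \<open>A\<close> generated by finitely many
  elements with finite conjugacy classes. The centralizer of \<open>A\<close> has a finite transversal \<open>T\<close>, and
  an element of \<open>A\<close> is determined modulo the center by its conjugation action on \<open>T\<close>, for which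
  \<open>K\<close> leaves finitely many possibilities.
\<close>

context group
begin

section \<open>Conjugation, centralizers and cosets of the center\<close>

lemma conjugate_mult_distrib:
  assumes "x \<in> carrier G" "y \<in> carrier G" "g \<in> carrier G"
  shows "conjugate G (x \<otimes> y) g = conjugate G x g \<otimes> conjugate G y g"
proof -
  have "g \<otimes> (inv g \<otimes> z) = z" if "z \<in> carrier G" for z
    using that assms by (simp add: m_assoc[symmetric])
  then show ?thesis
    using assms by (simp add: conjugate_def m_assoc)
qed

lemma conjugate_inv:
  assumes "x \<in> carrier G" "g \<in> carrier G"
  shows "conjugate G (inv x) g = inv (conjugate G x g)"
  using assms by (simp add: conjugate_def inv_mult_group m_assoc)

lemma conjugate_fixed_iff:
  assumes "x \<in> carrier G" "g \<in> carrier G"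
  shows "conjugate G x g = x \<longleftrightarrow> x \<otimes> g = g \<otimes> x"
  using assms by (simp add: conjugate_def m_assoc inv_solve_left')

text \<open>Both sides say that \<open>x\<close> and \<open>g\<close> commute. This exchanges the
  conjugated and the conjugating element, so that centralizers can be read from either side.\<close>

lemma conjugate_fixed_swap:
  assumes "x \<in> carrier G" "g \<in> carrier G"
  shows "conjugate G x g = x \<longleftrightarrow> conjugate G g x = g"
  using assms by (auto simp: conjugate_fixed_iff)

text \<open>The orbit-stabilizer correspondence: conjugates of \<open>x\<close> correspond to right
  cosets of the centralizer of \<open>x\<close>.\<close>

lemma conjugate_eq_iff:
  assumes "x \<in> carrier G" "g \<in> carrier G" "h \<in> carrier G"
  shows "conjugate G x g = conjugate G x h \<longleftrightarrow> conjugate G x (g \<otimes> inv h) = x"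
proof
  assume "conjugate G x g = conjugate G x h"
  then have "conjugate G (conjugate G x g) (inv h) = conjugate G (conjugate G x h) (inv h)"
    by simp
  then show "conjugate G x (g \<otimes> inv h) = x"
    using assms by (simp add: conjugate_mult conjugate_one)
next
  assume "conjugate G x (g \<otimes> inv h) = x"
  then have "conjugate G (conjugate G x (g \<otimes> inv h)) h = conjugate G x h"
    by simp
  then show "conjugate G x g = conjugate G x h"
    using assms by (simp add: conjugate_mult m_assoc)
qed

lemma center_iff_conjugate:
  assumes "z \<in> carrier G"
  shows "z \<in> center G \<longleftrightarrow> (\<forall>x\<in>carrier G. conjugate G x z = x)"
  using assms by (auto simp: center_def conjugate_fixed_iff)

text \<open>Each side amounts to \<open>g \<otimes> inv h\<close> being central. Finiteness modulo
  the center thus becomes a count of conjugation actions.\<close>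

lemma center_coset_eq_iff:
  assumes "g \<in> carrier G" "h \<in> carrier G"
  shows "center G #> g = center G #> h \<longleftrightarrow>
    (\<forall>x\<in>carrier G. conjugate G x g = conjugate G x h)"
proof -
  have sub: "subgroup (center G) G"
    using center_normal normal_imp_subgroup by blast
  have "center G #> g = center G #> h \<longleftrightarrow> center G #> (g \<otimes> inv h) = center G"
    using coset_mult_inv1[of "center G" g h] coset_mult_inv2[of "center G" g h] assms
      subgroup.subset[OF sub]
    by auto
  also have "\<dots> \<longleftrightarrow> g \<otimes> inv h \<in> center G"
    using coset_join1[of "center G" "g \<otimes> inv h"] coset_join2[of "g \<otimes> inv h" "center G"] assms sub
    by auto
  finally have "center G #> g = center G #> h \<longleftrightarrow> g \<otimes> inv h \<in> center G" .
  then show ?thesis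
    using assms by (simp add: center_iff_conjugate conjugate_eq_iff)
qed

lemma subgroup_centralizer:
  assumes "a \<in> carrier G"
  shows "subgroup {x \<in> carrier G. conjugate G a x = a} G"
proof (rule subgroupI)
  show "{x \<in> carrier G. conjugate G a x = a} \<noteq> {}"
    using assms conjugate_one by blast
  show "inv x \<in> {x \<in> carrier G. conjugate G a x = a}"
    if "x \<in> {x \<in> carrier G. conjugate G a x = a}" for x
    using that assms conjugate_eq_iff[of a "\<one>" x] by (auto simp: conjugate_one)
  show "x \<otimes> y \<in> {x \<in> carrier G. conjugate G a x = a}"
    if "x \<in> {x \<in> carrier G. conjugate G a x = a}" "y \<in> {x \<in> carrier G. conjugate G a x = a}"
    for x y
    using that assms by (auto simp: conjugate_mult[symmetric])
qed auto

text \<open>The centralizer of \<open>x\<close> is a subgroup, so it contains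
  \<open>generate G A\<close> as soon as it contains \<open>A\<close>.\<close>

lemma conjugate_generate_fixed:
  assumes "A \<subseteq> carrier G" "x \<in> carrier G" "\<And>a. a \<in> A \<Longrightarrow> conjugate G a x = a"
    and h: "h \<in> generate G A"
  shows "conjugate G h x = h"
proof -
  have "A \<subseteq> {g \<in> carrier G. conjugate G x g = x}"
    using assms(1,2,3) by (auto simp: conjugate_fixed_swap subset_iff)
  then have "generate G A \<subseteq> {g \<in> carrier G. conjugate G x g = x}"
    using generate_subgroup_incl subgroup_centralizer[OF assms(2)] by blast
  then show ?thesis
    using h assms(2) by (auto simp: conjugate_fixed_swap)
qed

section \<open>The FC-center and Neumann's covering lemma\<close>

definition fc_center :: "'a set" where
  "fc_center = {a \<in> carrier G. finite (conjugate G a ` carrier G)}"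

text \<open>Conjugation is a homomorphism, so each conjugate of \<open>a \<otimes> inv b\<close> is
  a quotient of a conjugate of \<open>a\<close> by one of \<open>b\<close>, and there are finitely
  many such pairs.\<close>

lemma fc_center_div:
  assumes a: "a \<in> fc_center" and b: "b \<in> fc_center"
  shows "a \<otimes> inv b \<in> fc_center"
proof -
  have c: "a \<in> carrier G" "b \<in> carrier G"
    using a b by (auto simp: fc_center_def)
  have "conjugate G (a \<otimes> inv b) ` carrier G \<subseteq>
      (\<lambda>(p, q). p \<otimes> inv q) ` ((conjugate G a ` carrier G) \<times> (conjugate G b ` carrier G))"
  proof
    fix y assume "y \<in> conjugate G (a \<otimes> inv b) ` carrier G"
    then obtain g where g: "g \<in> carrier G" "y = conjugate G (a \<otimes> inv b) g"
      by blast
    then have "y = conjugate G a g \<otimes> inv (conjugate G b g)"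
      using c by (simp add: conjugate_mult_distrib conjugate_inv)
    then show "y \<in> (\<lambda>(p, q). p \<otimes> inv q) `
        ((conjugate G a ` carrier G) \<times> (conjugate G b ` carrier G))"
      using g(1) by auto
  qed
  moreover have "finite \<dots>"
    using a b by (simp add: fc_center_def)
  ultimately show ?thesis
    using c by (simp add: fc_center_def finite_subset)
qed

text \<open>A pair \<open>(L, u)\<close> in the cover stands for the coset \<open>L u\<close>.\<close>

lemma neumann_covering:
  assumes "finite \<H>" "\<And>L. L \<in> \<H> \<Longrightarrow> subgroup L G"
    and "finite S" "S \<subseteq> \<H> \<times> carrier G"
    and "\<And>x. x \<in> carrier G \<Longrightarrow> \<exists>(L, u)\<in>S. x \<otimes> inv u \<in> L"
  shows "\<exists>L\<in>\<H>. \<exists>T. finite T \<and> T \<subseteq> carrier G \<and>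
    (\<forall>x\<in>carrier G. \<exists>t\<in>T. x \<otimes> inv t \<in> L)"
  using assms
proof (induction \<H> arbitrary: S rule: finite_induct)
  case empty
  then show ?case by force
next
  case (insert H \<H>)
  show ?case
  \<comment> \<open>Either finitely many cosets of \<open>H\<close> already cover the group, or the
    cover is rebuilt without cosets of \<open>H\<close> and the induction hypothesis
    applies.\<close>
  proof (cases "\<exists>T. finite T \<and> T \<subseteq> carrier G \<and> (\<forall>x\<in>carrier G. \<exists>t\<in>T. x \<otimes> inv t \<in> H)")
    case True
    then show ?thesis by blast
  next
    case False
    have H: "subgroup H G"
      using insert.prems by blast
    define V where "V = {u. (H, u) \<in> S}"
    have "V \<subseteq> snd ` S" by (force simp: V_def)
    then have finV: "finite V"
      using insert.prems(2) finite_subset by blast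
    have V: "V \<subseteq> carrier G"
      using insert.prems(3) by (auto simp: V_def)
    have "\<not> (\<forall>x\<in>carrier G. \<exists>t\<in>V. x \<otimes> inv t \<in> H)"
      using False finV V by simp
    then obtain g where g: "g \<in> carrier G" "\<And>u. u \<in> V \<Longrightarrow> g \<otimes> inv u \<notin> H"
      by blast
    define S0 where "S0 = {(L, u) \<in> S. L \<in> \<H>}"
    \<comment> \<open>The coset \<open>H g\<close> avoids all \<open>H\<close>-cosets of the cover, so it is covered by \<open>S0\<close>; hence every
      \<open>H\<close>-coset \<open>H v\<close> is covered by the translates of \<open>S0\<close> by \<open>g\<^sup>-\<^sup>1 v\<close>.\<close>
    define S1 where "S1 = S0 \<union> (\<lambda>((L, u), v). (L, u \<otimes> inv g \<otimes> v)) ` (S0 \<times> V)"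
    have "S0 \<subseteq> S" by (auto simp: S0_def)
    then have finS0: "finite S0"
      using insert.prems(2) finite_subset by blast
    have S0: "S0 \<subseteq> \<H> \<times> carrier G"
      using insert.prems(3) by (auto simp: S0_def)
    have "finite S1"
      using finS0 finV by (simp add: S1_def)
    moreover have "S1 \<subseteq> \<H> \<times> carrier G"
      using S0 V g(1) by (auto simp: S1_def)
    moreover have "\<exists>(L, u)\<in>S1. x \<otimes> inv u \<in> L" if x: "x \<in> carrier G" for x
    proof -
      obtain M v where Mv: "(M, v) \<in> S" "x \<otimes> inv v \<in> M"
        using insert.prems(4)[OF x] by blast
      show ?thesis
      proof (cases "M = H")
        case False
        then have "(M, v) \<in> S1"
          using Mv(1) insert.prems(3) by (auto simp: S1_def S0_def)
        then show ?thesis using Mv(2) by blast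
      next
        case True
        then have v: "v \<in> V" using Mv by (simp add: V_def)
        then have vc: "v \<in> carrier G" using V by blast
        \<comment> \<open>Right translation by \<open>inv v \<otimes> g\<close> moves
          \<open>x\<close> from \<open>H v\<close> into \<open>H g\<close>. A coset in
          \<open>S0\<close> containing \<open>y\<close> is then translated back to one containing
          \<open>x\<close>.\<close>
        define y where "y = x \<otimes> inv v \<otimes> g"
        have yc: "y \<in> carrier G" using x vc g by (simp add: y_def)
        have yH: "y \<otimes> inv g \<in> H"
          using Mv(2) True x vc g by (simp add: y_def m_assoc)
        obtain L u where Lu: "(L, u) \<in> S" "y \<otimes> inv u \<in> L"
          using insert.prems(4)[OF yc] by blast
        have uc: "u \<in> carrier G" using Lu insert.prems(3) by blast
        \<comment> \<open>If \<open>L = H\<close>, then \<open>H g\<close> and \<open>H u\<close>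
          share the point \<open>y\<close> and coincide, against the choice of
          \<open>g\<close>.\<close>
        have "L \<noteq> H"
        proof
          assume "L = H"
          then have "inv (y \<otimes> inv g) \<otimes> (y \<otimes> inv u) \<in> H"
            using H yH Lu(2) by (simp add: subgroup.m_closed subgroup.m_inv_closed)
          also have "inv (y \<otimes> inv g) \<otimes> (y \<otimes> inv u) = g \<otimes> (inv y \<otimes> (y \<otimes> inv u))"
            using yc g(1) uc by (simp add: inv_mult_group m_assoc)
          also have "\<dots> = g \<otimes> inv u"
            using yc g(1) uc by (simp add: m_assoc[symmetric])
          finally show False
            using g(2)[of u] Lu(1) \<open>L = H\<close> by (simp add: V_def)
        qed
        then have "(L, u) \<in> S0"
          using Lu(1) insert.prems(3) by (auto simp: S0_def)
        then have "(L, u \<otimes> inv g \<otimes> v) \<in> S1"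
          using v by (force simp: S1_def)
        moreover have "x \<otimes> inv (u \<otimes> inv g \<otimes> v) = y \<otimes> inv u"
          using x uc vc g(1) by (simp add: y_def inv_mult_group m_assoc)
        ultimately show ?thesis
          using Lu(2) by (intro bexI[of _ "(L, u \<otimes> inv g \<otimes> v)"]) simp_all
      qed
    qed
    ultimately obtain L where "L \<in> \<H>" "\<exists>T. finite T \<and> T \<subseteq> carrier G \<and>
        (\<forall>x\<in>carrier G. \<exists>t\<in>T. x \<otimes> inv t \<in> L)"
      using insert.IH[of S1] insert.prems(1) by blast
    then show ?thesis by blast
  qed
qed

text \<open>The hypothesis places each \<open>x\<close> in the centralizer of some
  \<open>h \<otimes> inv k\<close>. Neumann's lemma gives one of these finitely many centralizers a
  finite transversal, and its cosets correspond to the conjugates of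
  \<open>h \<otimes> inv k\<close>.\<close>

lemma fc_center_if_conjugates_covered:
  assumes K: "finite K" "K \<subseteq> carrier G" and h: "h \<in> carrier G"
    and cov: "\<And>x. x \<in> carrier G \<Longrightarrow> conjugate G x h \<in> conjugate G x ` K"
  shows "\<exists>k\<in>K. h \<otimes> inv k \<in> fc_center"
proof -
  define C where "C = (\<lambda>k. {x \<in> carrier G. conjugate G (h \<otimes> inv k) x = h \<otimes> inv k})"
  have hk: "h \<otimes> inv k \<in> carrier G" if "k \<in> K" for k
    using that h K by auto
  have "\<exists>L\<in>C ` K. \<exists>T. finite T \<and> T \<subseteq> carrier G \<and>
    (\<forall>x\<in>carrier G. \<exists>t\<in>T. x \<otimes> inv t \<in> L)"
  proof (rule neumann_covering)
    show "subgroup L G" if "L \<in> C ` K" for L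
      using that hk subgroup_centralizer by (auto simp: C_def)
    \<comment> \<open>The cover consists of the centralizers themselves, hence the sole coset
      representative \<open>\<one>\<close>.\<close>
    show "C ` K \<times> {\<one>} \<subseteq> C ` K \<times> carrier G"
      by auto
    show "\<exists>(L, u)\<in>C ` K \<times> {\<one>}. x \<otimes> inv u \<in> L" if x: "x \<in> carrier G" for x
    proof -
      obtain k where k: "k \<in> K" "conjugate G x h = conjugate G x k"
        using cov[OF x] by blast
      then have "conjugate G x (h \<otimes> inv k) = x"
        using x h K by (auto simp: conjugate_eq_iff[symmetric])
      then have "x \<in> C k"
        using x k(1) hk by (simp add: C_def conjugate_fixed_swap)
      then show ?thesis
        using k x by auto
    qed
  qed (use K in auto)
  then obtain k T where k: "k \<in> K" and T: "finite T" "T \<subseteq> carrier G"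
    "\<And>x. x \<in> carrier G \<Longrightarrow> \<exists>t\<in>T. x \<otimes> inv t \<in> C k"
    by blast
  have "conjugate G (h \<otimes> inv k) ` carrier G \<subseteq> conjugate G (h \<otimes> inv k) ` T"
  proof
    fix y assume "y \<in> conjugate G (h \<otimes> inv k) ` carrier G"
    then obtain x where x: "x \<in> carrier G" "y = conjugate G (h \<otimes> inv k) x"
      by blast
    then obtain t where t: "t \<in> T" "x \<otimes> inv t \<in> C k"
      using T(3) by blast
    then have "y = conjugate G (h \<otimes> inv k) t"
      using x hk[OF k] T(2) conjugate_eq_iff[of "h \<otimes> inv k" x t] by (auto simp: C_def)
    then show "y \<in> conjugate G (h \<otimes> inv k) ` T"
      using t by blast
  qed
  then have "h \<otimes> inv k \<in> fc_center"
    using hk[OF k] T(1) by (simp add: fc_center_def finite_surj)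
  then show ?thesis using k by blast
qed

section \<open>Finite representatives and Schreier generators\<close>

text \<open>The simultaneous action of \<open>g\<close> on \<open>A\<close> is a point of a finite
  product of sets of conjugates; \<open>T\<close> picks one preimage of each point attained.\<close>

lemma finite_representatives_conjugation:
  assumes "finite A" "A \<subseteq> carrier G" "\<And>a. a \<in> A \<Longrightarrow> finite (conjugate G a ` X)"
  obtains T where "finite T" "T \<subseteq> X"
    "\<And>g. g \<in> X \<Longrightarrow> \<exists>t\<in>T. \<forall>a\<in>A. conjugate G a g = conjugate G a t"
proof -
  \<comment> \<open>\<open>restrict\<close> makes the actions extensional functions, so that they
    lie in the finite set \<open>\<Pi>\<^sub>E\<close>.\<close>
  define f where "f = (\<lambda>g. restrict (\<lambda>a. conjugate G a g) A)"
  have "f ` X \<subseteq> (\<Pi>\<^sub>E a\<in>A. conjugate G a ` X)"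
    by (auto simp: f_def)
  moreover have "finite (\<Pi>\<^sub>E a\<in>A. conjugate G a ` X)"
    using assms by (intro finite_PiE) auto
  ultimately have "finite (f ` X)"
    using finite_subset by blast
  then obtain T where T: "T \<subseteq> X" "finite T" "f ` X = f ` T"
    by (meson finite_subset_image order_refl)
  have "\<exists>t\<in>T. \<forall>a\<in>A. conjugate G a g = conjugate G a t" if "g \<in> X" for g
  proof -
    obtain t where "t \<in> T" "f g = f t"
      using \<open>g \<in> X\<close> T(3) by blast
    then show ?thesis
      unfolding f_def by (metis restrict_apply')
  qed
  then show thesis using that T by blast
qed

text \<open>Schreier's rewriting: moving a representative from left to right past a generator leaves
  behind one element of \<open>B\<close>. Reading a word this way collects an element of
  \<open>generate G B\<close> and ends with a representative.\<close>

lemma generate_factorization: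
  assumes F: "finite F" "F \<subseteq> carrier G" and R: "finite R" "R \<subseteq> generate G F" "\<one> \<in> R"
    and dec: "\<And>h. h \<in> generate G F \<Longrightarrow> \<exists>r\<in>R. h \<otimes> inv r \<in> N"
  obtains B where "finite B" "B \<subseteq> N" "B \<subseteq> generate G F"
    "\<And>h. h \<in> generate G F \<Longrightarrow> \<exists>a\<in>generate G B. \<exists>r\<in>R. h = a \<otimes> r"
proof -
  have HC: "generate G F \<subseteq> carrier G" using generate_incl[OF F(2)] .
  have sub: "subgroup (generate G F) G" using generate_is_subgroup[OF F(2)] .
  obtain \<rho> where \<rho>: "\<And>h. h \<in> generate G F \<Longrightarrow> \<rho> h \<in> R \<and> h \<otimes> inv (\<rho> h) \<in> N"
    using dec by metis
  \<comment> \<open>\<open>B\<close> consists of the Schreier generators. Inverses of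
    \<open>F\<close> are included because words in \<open>generate G F\<close> may use them as
    letters.\<close>
  define Y where "Y = (\<lambda>(r, f). r \<otimes> f) ` (R \<times> (F \<union> m_inv G ` F))"
  define B where "B = (\<lambda>h. h \<otimes> inv (\<rho> h)) ` Y"
  have YH: "Y \<subseteq> generate G F"
    using R(2) by (auto simp: Y_def intro!: generate.eng intro: generate.incl generate.inv)
  have BH: "B \<subseteq> generate G F"
    using YH \<rho> R(2) sub unfolding B_def
    by (auto intro!: generate.eng subgroup.m_inv_closed)
  have BC: "B \<subseteq> carrier G" using BH HC by blast
  have RC: "R \<subseteq> carrier G" using R HC by blast
  have AC: "generate G B \<subseteq> carrier G" using generate_incl[OF BC] .
  have step: "\<exists>a\<in>generate G B. \<exists>s\<in>R. r \<otimes> f = a \<otimes> s"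
    if "r \<in> R" "f \<in> F \<union> m_inv G ` F" for r f
  proof -
    have y: "r \<otimes> f \<in> Y" using that unfolding Y_def by force
    then have c: "r \<otimes> f \<in> carrier G" "\<rho> (r \<otimes> f) \<in> R"
      using YH HC \<rho> by blast+
    have "r \<otimes> f \<otimes> inv (\<rho> (r \<otimes> f)) \<in> generate G B"
      using y unfolding B_def by (intro generate.incl) blast
    moreover have "r \<otimes> f = r \<otimes> f \<otimes> inv (\<rho> (r \<otimes> f)) \<otimes> \<rho> (r \<otimes> f)"
      using inv_solve_right'[of "r \<otimes> f \<otimes> inv (\<rho> (r \<otimes> f))" "r \<otimes> f" "\<rho> (r \<otimes> f)"] c RC
      by blast
    ultimately show ?thesis using c(2) by blast
  qed
  \<comment> \<open>The induction needs an arbitrary starting representative \<open>r\<close>, since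
    the second factor of a product starts from the one left by the first. Taking
    \<open>r = \<one>\<close> then gives the factorization.\<close>
  have "\<exists>a\<in>generate G B. \<exists>s\<in>R. r \<otimes> h = a \<otimes> s"
    if h: "h \<in> generate G F" and r: "r \<in> R" for r h
    using h r
  proof (induction h arbitrary: r rule: generate.induct)
    case one
    then show ?case using RC generate.one by (metis l_one r_one subset_iff)
  next
    case (incl f)
    then show ?case using step by blast
  next
    case (inv f)
    then show ?case using step by blast
  next
    case (eng g h)
    obtain a s where 1: "a \<in> generate G B" "s \<in> R" "r \<otimes> g = a \<otimes> s"
      using eng by blast
    obtain b t where 2: "b \<in> generate G B" "t \<in> R" "s \<otimes> h = b \<otimes> t"
      using eng 1 by blast
    have c: "r \<in> carrier G" "g \<in> carrier G" "h \<in> carrier G" "a \<in> carrier G" "b \<in> carrier G"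
      "s \<in> carrier G" "t \<in> carrier G"
      using 1 2 eng HC RC AC by blast+
    have "r \<otimes> (g \<otimes> h) = (r \<otimes> g) \<otimes> h" using c by (simp add: m_assoc)
    also have "\<dots> = a \<otimes> (s \<otimes> h)" using c by (simp add: 1 m_assoc)
    also have "\<dots> = (a \<otimes> b) \<otimes> t" using c by (simp add: 2 m_assoc)
    finally have "r \<otimes> (g \<otimes> h) = (a \<otimes> b) \<otimes> t" .
    then show ?case
      using generate.eng[OF 1(1) 2(1)] 2(2) by blast
  qed
  from this[OF _ R(3)] have "\<exists>a\<in>generate G B. \<exists>r\<in>R. h = a \<otimes> r"
    if "h \<in> generate G F" for h
    using that HC by (metis l_one subset_iff)
  moreover have "finite B"
    using F R by (simp add: B_def Y_def)
  moreover have "B \<subseteq> N"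
    using YH \<rho> by (auto simp: B_def)
  ultimately show thesis using that BH by blast
qed

section \<open>Finiteness modulo the center\<close>

lemma finite_center_cosets_if_conjugates_covered:
  assumes F: "finite F" "F \<subseteq> carrier G" and K: "finite K" "K \<subseteq> carrier G"
    and cov: "\<And>h x. h \<in> generate G F \<Longrightarrow> x \<in> carrier G \<Longrightarrow>
      conjugate G x h \<in> conjugate G x ` K"
  shows "finite ((\<lambda>h. center G #> h) ` generate G F)"
proof -
  define H where "H = generate G F"
  have HC: "H \<subseteq> carrier G" using generate_incl[OF F(2)] by (simp add: H_def)
  have "\<exists>k\<in>K. h \<otimes> inv k \<in> fc_center" if "h \<in> H" for h
    using fc_center_if_conjugates_covered[OF K] cov that HC by (auto simp: H_def)
  then obtain \<kappa> where \<kappa>: "\<And>h. h \<in> H \<Longrightarrow> \<kappa> h \<in> K \<and> h \<otimes> inv (\<kappa> h) \<in> fc_center"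
    by metis
  have "\<kappa> ` H \<subseteq> K" using \<kappa> by blast
  then have "finite (\<kappa> ` H)" using K(1) finite_subset by blast
  \<comment> \<open>Schreier's argument needs representatives inside \<open>H\<close>, whereas
    \<open>K\<close> may lie outside. One element of \<open>H\<close> is chosen for each value of
    \<open>\<kappa>\<close>; elements with equal value differ by an element of
    \<open>fc_center\<close>.\<close>
  then obtain R0 where R0: "R0 \<subseteq> H" "finite R0" "\<kappa> ` H = \<kappa> ` R0"
    by (meson finite_subset_image order_refl)
  define R where "R = insert \<one> R0"
  have R: "finite R" "R \<subseteq> H" "\<one> \<in> R"
    using R0 by (auto simp: R_def H_def generate.one)
  have RC: "R \<subseteq> carrier G" using R HC by blast
  have "\<exists>r\<in>R. h \<otimes> inv r \<in> fc_center" if h: "h \<in> H" for h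
  proof -
    obtain r where r: "r \<in> R0" "\<kappa> h = \<kappa> r" using R0 h by blast
    then have rH: "r \<in> H" using R0 by blast
    have c: "h \<in> carrier G" "r \<in> carrier G" "\<kappa> r \<in> carrier G"
      using h rH HC \<kappa>[OF rH] K(2) by auto
    have "(h \<otimes> inv (\<kappa> r)) \<otimes> inv (r \<otimes> inv (\<kappa> r)) \<in> fc_center"
      using fc_center_div \<kappa>[OF h] \<kappa>[OF rH] r(2) by simp
    also have "(h \<otimes> inv (\<kappa> r)) \<otimes> inv (r \<otimes> inv (\<kappa> r)) = h \<otimes> (inv (\<kappa> r) \<otimes> (\<kappa> r \<otimes> inv r))"
      using c by (simp add: inv_mult_group m_assoc)
    also have "\<dots> = h \<otimes> inv r"
      using c by (simp add: m_assoc[symmetric])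
    finally show ?thesis using r by (auto simp: R_def)
  qed
  then obtain B where B: "finite B" "B \<subseteq> fc_center" "B \<subseteq> H"
    "\<And>h. h \<in> H \<Longrightarrow> \<exists>a\<in>generate G B. \<exists>r\<in>R. h = a \<otimes> r"
    using generate_factorization[OF F, of R fc_center] R unfolding H_def by blast
  define A where "A = generate G B"
  have BC: "B \<subseteq> carrier G" using B HC by blast
  have AC: "A \<subseteq> carrier G" using generate_incl[OF BC] by (simp add: A_def)
  have subA: "subgroup A G" using generate_is_subgroup[OF BC] by (simp add: A_def)
  have AH: "A \<subseteq> H"
    using B(3) generate_subgroup_incl generate_is_subgroup[OF F(2)] by (simp add: A_def H_def)
  obtain T where T: "finite T" "T \<subseteq> carrier G"
    "\<And>g. g \<in> carrier G \<Longrightarrow> \<exists>t\<in>T. \<forall>b\<in>B. conjugate G b g = conjugate G b t"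
    using finite_representatives_conjugation[OF B(1) BC, of "carrier G"] B(2)
    by (auto simp: fc_center_def)
  \<comment> \<open>\<open>A\<close> lies in \<open>H\<close>, so the hypothesis on \<open>K\<close>
    bounds the conjugates of \<open>t\<close> under all of \<open>A\<close>.\<close>
  have "finite (conjugate G t ` A)" if "t \<in> T" for t
  proof (rule finite_subset)
    show "conjugate G t ` A \<subseteq> conjugate G t ` K"
      using cov that T(2) AH unfolding H_def by blast
  qed (use K in simp)
  then obtain Q where Q: "finite Q" "Q \<subseteq> A"
    "\<And>a. a \<in> A \<Longrightarrow> \<exists>q\<in>Q. \<forall>t\<in>T. conjugate G t a = conjugate G t q"
    using finite_representatives_conjugation[OF T(1,2), of A] by blast
  \<comment> \<open>With \<open>t\<close> acting on \<open>B\<close> as \<open>x\<close> does,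
    \<open>x \<otimes> inv t\<close> centralizes \<open>B\<close>, hence \<open>A\<close> and
    \<open>d\<close>. Since \<open>t\<close> commutes with \<open>d\<close> too, so does
    \<open>x\<close>.\<close>
  have central: "conjugate G x d = x"
    if d: "d \<in> A" "\<forall>t\<in>T. conjugate G t d = t" and x: "x \<in> carrier G" for d x
  proof -
    obtain t where t: "t \<in> T" "\<forall>b\<in>B. conjugate G b x = conjugate G b t"
      using T(3) x by blast
    have c: "t \<in> carrier G" "d \<in> carrier G" using t T d AC by blast+
    have "conjugate G d (x \<otimes> inv t) = d"
    proof (rule conjugate_generate_fixed[OF BC])
      show "x \<otimes> inv t \<in> carrier G" using x c by simp
      show "conjugate G b (x \<otimes> inv t) = b" if "b \<in> B" for b
        using t(2) that BC x c by (auto simp: conjugate_eq_iff[symmetric])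
      show "d \<in> generate G B" using d by (simp add: A_def)
    qed
    then have "conjugate G d x = conjugate G d t"
      using x c by (simp add: conjugate_eq_iff)
    also have "\<dots> = d"
      using d(2) t(1) c by (simp add: conjugate_fixed_swap[of d t])
    finally show ?thesis
      using x c by (simp add: conjugate_fixed_swap[of d x])
  qed
  \<comment> \<open>In \<open>h = a \<otimes> r\<close>, \<open>a\<close> may be replaced by the
    \<open>q\<close> with the same action on \<open>T\<close>: \<open>a \<otimes> inv q\<close> is
    central by \<open>central\<close>.\<close>
  have "(\<lambda>h. center G #> h) ` H \<subseteq> (\<lambda>(q, r). center G #> (q \<otimes> r)) ` (Q \<times> R)"
  proof
    fix y assume "y \<in> (\<lambda>h. center G #> h) ` H"
    then obtain h where h: "h \<in> H" "y = center G #> h" by blast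
    then obtain a r where ar: "a \<in> A" "r \<in> R" "h = a \<otimes> r"
      using B(4) unfolding A_def by blast
    obtain q where q: "q \<in> Q" "\<forall>t\<in>T. conjugate G t a = conjugate G t q"
      using Q(3) ar(1) by blast
    have c: "a \<in> carrier G" "r \<in> carrier G" "q \<in> carrier G" "q \<in> A"
      using ar q Q(2) AC RC by blast+
    have "a \<otimes> inv q \<in> A"
      using ar(1) c(4) subA by (simp add: subgroup.m_closed subgroup.m_inv_closed)
    moreover have "\<forall>t\<in>T. conjugate G t (a \<otimes> inv q) = t"
      using q(2) T(2) c by (auto simp: conjugate_eq_iff[symmetric])
    ultimately have "conjugate G x a = conjugate G x q" if "x \<in> carrier G" for x
      using central that c by (simp add: conjugate_eq_iff)
    then have "center G #> (a \<otimes> r) = center G #> (q \<otimes> r)"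
      using c by (simp add: center_coset_eq_iff conjugate_mult[symmetric])
    then show "y \<in> (\<lambda>(q, r). center G #> (q \<otimes> r)) ` (Q \<times> R)"
      using h ar q by force
  qed
  then have "finite ((\<lambda>h. center G #> h) ` H)"
    by (rule finite_subset) (simp add: Q(1) R(1))
  then show ?thesis by (simp only: H_def)
qed

section \<open>Local finiteness and cellularity in terms of conjugation\<close>

text \<open>The projection maps generated subgroups onto generated subgroups, and every finite
  subset of the quotient lifts to a finite subset of the group.\<close>

lemma locally_finite_Mod_center_iff:
  "locally_finite (G Mod center G) \<longleftrightarrow>
    (\<forall>F. F \<subseteq> carrier G \<and> finite F \<longrightarrow> finite ((\<lambda>g. center G #> g) ` generate G F))"
proof -
  interpret N: normal "center G" G by (rule center_normal)
  interpret \<pi>: group_hom G "G Mod center G" "\<lambda>g. center G #> g"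
    by (simp add: group_hom_def group_hom_axioms_def N.factorgroup_is_group N.r_coset_hom_Mod
        group_axioms)
  have img: "(\<lambda>g. center G #> g) ` generate G F = generate (G Mod center G) ((\<lambda>g. center G #> g) ` F)"
    if "F \<subseteq> carrier G" for F
    using \<pi>.generate_img[OF that] by simp
  have "carrier (G Mod center G) = (\<lambda>g. center G #> g) ` carrier G"
    by (auto simp: FactGroup_def RCOSETS_def)
  then have "(\<forall>S. S \<subseteq> carrier (G Mod center G) \<and> finite S \<longrightarrow> finite (generate (G Mod center G) S))
    \<longleftrightarrow> (\<forall>F. F \<subseteq> carrier G \<and> finite F \<longrightarrow>
      finite (generate (G Mod center G) ((\<lambda>g. center G #> g) ` F)))"
    by (metis finite_imageI finite_subset_image image_mono)
  then show ?thesis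
    using img N.factorgroup_is_group by (auto simp: locally_finite_def)
qed

lemma mem_conj_coarse_iff:
  "E \<in> conj_coarse G \<longleftrightarrow> Id_on (carrier G) \<subseteq> E \<and>
    (\<exists>F. F \<subseteq> carrier G \<and> finite F \<and> \<one> \<in> F \<and> E \<subseteq> conj_entourage G F)"
  unfolding conj_coarse_def coarse_structure_with_base_def conj_entourages_def by blast

text \<open>This is the orbit relation of \<open>H\<close> acting by conjugation.\<close>

lemma equiv_conj_entourage:
  assumes "subgroup H G"
  shows "equiv (carrier G) (conj_entourage G H)"
proof -
  interpret H: subgroup H G by fact
  have HC: "h \<in> H \<Longrightarrow> h \<in> carrier G" for h
    by (rule H.mem_carrier)
  show ?thesis
  proof (rule equivI)
    show "conj_entourage G H \<subseteq> carrier G \<times> carrier G"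
      by (auto simp: conj_entourage_def)
    show "refl_on (carrier G) (conj_entourage G H)"
      unfolding refl_on_def conj_entourage_def using conjugate_one H.one_closed
      by (auto intro!: image_eqI[of _ _ "\<one>"])
    show "sym (conj_entourage G H)"
    proof (rule symI)
      fix x y assume "(x, y) \<in> conj_entourage G H"
      then obtain h where h: "x \<in> carrier G" "y \<in> carrier G" "h \<in> H" "y = conjugate G x h"
        by (auto simp: conj_entourage_def)
      then have "x = conjugate G y (inv h)"
        using HC by (simp add: conjugate_mult conjugate_one)
      then show "(y, x) \<in> conj_entourage G H"
        using h by (auto simp: conj_entourage_def)
    qed
    show "trans (conj_entourage G H)"
      by (rule transI) (auto simp: conj_entourage_def conjugate_mult HC)
  qed
qed

text \<open>An equivalence relation containing the entourage of \<open>F\<close> contains that of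
  \<open>generate G F\<close>, and as an entourage it lies below some finite \<open>K\<close>.
  Conversely, the orbit relations of finitely generated subgroups form the required base.\<close>

lemma cellular_conj_coarse_iff:
  "cellular (carrier G) (conj_coarse G) \<longleftrightarrow>
    (\<forall>F. F \<subseteq> carrier G \<and> finite F \<longrightarrow>
      (\<exists>K. K \<subseteq> carrier G \<and> finite K \<and>
        (\<forall>h\<in>generate G F. \<forall>x\<in>carrier G. conjugate G x h \<in> conjugate G x ` K)))"
  (is "?L \<longleftrightarrow> ?R")
proof
  assume ?L
  then obtain \<B> where \<B>: "coarse_base \<B> (conj_coarse G)" "\<And>R. R \<in> \<B> \<Longrightarrow> equiv (carrier G) R"
    by (auto simp: cellular_def)
  show ?R
  proof (intro allI impI, elim conjE)
    fix F assume F: "F \<subseteq> carrier G" "finite F"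
    have "conj_entourage G (insert \<one> F) \<in> conj_entourages G"
      using F by (auto simp: conj_entourages_def)
    then have "conj_entourage G (insert \<one> F) \<in> conj_coarse G"
      using conj_entourages_base by (auto simp: coarse_base_def)
    then obtain R where R: "R \<in> \<B>" "conj_entourage G (insert \<one> F) \<subseteq> R"
      using \<B>(1) by (auto simp: coarse_base_def)
    then have "R \<in> conj_coarse G"
      using \<B>(1) by (auto simp: coarse_base_def)
    then obtain K where K: "K \<subseteq> carrier G" "finite K" "R \<subseteq> conj_entourage G K"
      by (auto simp: mem_conj_coarse_iff)
    have eq: "equiv (carrier G) R" using \<B>(2) R(1) .
    have gen: "(x, conjugate G x f) \<in> R" if "f \<in> insert \<one> F" "x \<in> carrier G" for x f
      using that F(1) R(2) by (auto simp: conj_entourage_def conjugate_closed subset_iff)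
    have "(x, conjugate G x h) \<in> R" if h: "h \<in> generate G F" and x: "x \<in> carrier G" for h x
      using h x
    proof (induction h arbitrary: x rule: generate.induct)
      case one
      then show ?case using gen by blast
    next
      case (incl f)
      then show ?case using gen by blast
    next
      case (inv f)
      then have f: "f \<in> carrier G" using F by blast
      \<comment> \<open>Conjugating by \<open>f\<close> leads from
        \<open>conjugate G x (inv f)\<close> back to \<open>x\<close>; symmetry of \<open>R\<close>
        reverses the pair.\<close>
      then have "(conjugate G x (inv f), conjugate G (conjugate G x (inv f)) f) \<in> R"
        using inv gen by (simp add: conjugate_closed)
      then have "(conjugate G x (inv f), x) \<in> R"
        using f inv by (simp add: conjugate_mult conjugate_one)
      then show ?case using eq by (meson equivE symD)
    next
      case (eng g h)
      have c: "g \<in> carrier G" "h \<in> carrier G"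
        using eng F generate_in_carrier by blast+
      have "(x, conjugate G x g) \<in> R"
        using eng by blast
      moreover have "(conjugate G x g, conjugate G (conjugate G x g) h) \<in> R"
        using eng c by (simp add: conjugate_closed)
      ultimately have "(x, conjugate G (conjugate G x g) h) \<in> R"
        using eq by (meson equivE transD)
      then show ?case using c eng.prems by (simp add: conjugate_mult)
    qed
    then show "\<exists>K. K \<subseteq> carrier G \<and> finite K \<and>
        (\<forall>h\<in>generate G F. \<forall>x\<in>carrier G. conjugate G x h \<in> conjugate G x ` K)"
      using K unfolding conj_entourage_def by blast
  qed
next
  assume R: ?R
  define \<B> where "\<B> = {conj_entourage G (generate G F) | F. F \<subseteq> carrier G \<and> finite F}"
  have eq: "equiv (carrier G) E" if "E \<in> \<B>" for E
    using that equiv_conj_entourage generate_is_subgroup by (auto simp: \<B>_def)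
  have "E \<in> conj_coarse G" if E: "E \<in> \<B>" for E
  proof -
    obtain F where F: "F \<subseteq> carrier G" "finite F" "E = conj_entourage G (generate G F)"
      using E by (auto simp: \<B>_def)
    then obtain K where K: "K \<subseteq> carrier G" "finite K"
      "\<forall>h\<in>generate G F. \<forall>x\<in>carrier G. conjugate G x h \<in> conjugate G x ` K"
      using R[THEN spec, THEN mp, OF conjI[OF F(1,2)]] by (elim exE conjE)
    have "E \<subseteq> conj_entourage G (insert \<one> K)"
    proof
      fix p assume "p \<in> E"
      then obtain x h where "p = (x, conjugate G x h)" "x \<in> carrier G"
        "conjugate G x h \<in> carrier G" "h \<in> generate G F"
        unfolding F(3) conj_entourage_def by blast
      then show "p \<in> conj_entourage G (insert \<one> K)"
        using K(3) by (simp add: conj_entourage_def)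
    qed
    moreover have "Id_on (carrier G) \<subseteq> E"
      using eq[OF E] by (auto simp: equiv_def refl_on_def)
    moreover have "insert \<one> K \<subseteq> carrier G" "finite (insert \<one> K)" "\<one> \<in> insert \<one> K"
      using K by auto
    ultimately show ?thesis
      unfolding mem_conj_coarse_iff by blast
  qed
  moreover have "\<exists>E'\<in>\<B>. E \<subseteq> E'" if E: "E \<in> conj_coarse G" for E
  proof -
    obtain F where F: "F \<subseteq> carrier G" "finite F" "E \<subseteq> conj_entourage G F"
      using E unfolding mem_conj_coarse_iff by blast
    moreover have "conj_entourage G F \<subseteq> conj_entourage G (generate G F)"
      by (auto simp: conj_entourage_def intro: generate.incl)
    ultimately show ?thesis
      unfolding \<B>_def by blast
  qed
  ultimately have "coarse_base \<B> (conj_coarse G)"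
    by (auto simp: coarse_base_def)
  then show ?L
    using eq conj_coarse_structure by (auto simp: cellular_def)
qed

text \<open>Conjugation by \<open>h\<close> depends only on its coset modulo the center, so
  \<open>K\<close> can be a set of coset representatives.\<close>

lemma conjugates_covered_if_finite_center_cosets:
  assumes "F \<subseteq> carrier G" "finite ((\<lambda>h. center G #> h) ` generate G F)"
  shows "\<exists>K. K \<subseteq> carrier G \<and> finite K \<and>
    (\<forall>h\<in>generate G F. \<forall>x\<in>carrier G. conjugate G x h \<in> conjugate G x ` K)"
proof -
  have HC: "generate G F \<subseteq> carrier G" using generate_incl[OF assms(1)] .
  obtain K where K: "K \<subseteq> generate G F" "finite K"
    "(\<lambda>h. center G #> h) ` generate G F = (\<lambda>h. center G #> h) ` K"
    using finite_subset_image[OF assms(2) order_refl] by blast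
  have "conjugate G x h \<in> conjugate G x ` K" if h: "h \<in> generate G F" and x: "x \<in> carrier G" for h x
  proof -
    obtain k where k: "k \<in> K" "center G #> h = center G #> k"
      using h K(3) by blast
    then have "conjugate G x h = conjugate G x k"
      using center_coset_eq_iff[of h k] h x HC K(1) by blast
    then show ?thesis using k by blast
  qed
  moreover have "K \<subseteq> carrier G" using K(1) HC by blast
  ultimately show ?thesis using K(2) by blast
qed

end

theorem theorem5:
  fixes G :: "('a, 'b) monoid_scheme"
  assumes "group G"
  shows "cellular (carrier G) (conj_coarse G) \<longleftrightarrow> locally_finite (G Mod center G)"
proof -
  interpret group G by fact
  show ?thesis
    \<comment> \<open>Both sides now quantify over the same finite sets \<open>F\<close>, so the
      conditions are compared for each \<open>F\<close> separately.\<close>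
    unfolding cellular_conj_coarse_iff locally_finite_Mod_center_iff
  proof (intro iff_allI imp_cong refl iffI)
    fix F assume F: "F \<subseteq> carrier G \<and> finite F"
    show "finite ((\<lambda>g. center G #>\<^bsub>G\<^esub> g) ` generate G F)"
      if "\<exists>K. K \<subseteq> carrier G \<and> finite K \<and>
        (\<forall>h\<in>generate G F. \<forall>x\<in>carrier G. conjugate G x h \<in> conjugate G x ` K)"
      using that F by (elim exE conjE) (rule finite_center_cosets_if_conjugates_covered, auto)
    show "\<exists>K. K \<subseteq> carrier G \<and> finite K \<and>
        (\<forall>h\<in>generate G F. \<forall>x\<in>carrier G. conjugate G x h \<in> conjugate G x ` K)"
      if "finite ((\<lambda>g. center G #>\<^bsub>G\<^esub> g) ` generate G F)"
      using that F conjugates_covered_if_finite_center_cosets by simp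
  qed
qed

end
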